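(* Let $(x(t),y(t),z(t))$ be an S-torus knot with parameters $R,r,a,p,q$. Then for all $t\in\mathbb{R}$ $$\Big[R-\sqrt{x^2(t)+y^2(t)}\Big]^2+z^2(t)=r^2+(a^2-r^2)\sin^2(qt).$$
   Context: Let $p,q$ be positive integers and let $R>r>0$, $a>0$ be real. The S-torus knot with these parameters is the curve in $\mathbb{R}^3$ given by $$x(t)=[R+r\cos(qt)]\cos(pt),\quad y(t)=[R+r\cos(qt)]\sin(pt),\quad z(t)=a\sin(qt).$$ *)

theory Defs
  imports "HOL-Analysis.Analysis"
begin

definition S_torus_knot :: "real \<Rightarrow> real \<Rightarrow> real \<Rightarrow> nat \<Rightarrow> nat \<Rightarrow> real \<Rightarrow> real ^ 3" where
  "S_torus_knot R r a p q t =
     vector [(R + r * cos (real q * t)) * cos (real p * t),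
             (R + r * cos (real q * t)) * sin (real p * t),
             a * sin (real q * t)]"

end

theory Submission
  imports Defs
begin

text \<open>In the half-plane through the axis that rotates with the angle \<^term>\<open>p * t\<close>, the curve has the
  polar distance \<^term>\<open>R + r * cos (q * t)\<close> from the axis, as this number is positive for
  \<^term>\<open>r < R\<close>. So the point of that half-plane with distance \<^term>\<open>R\<close> and height zero is the centre
  of an ellipse with semi-axes \<^term>\<open>r\<close> and \<^term>\<open>a\<close> on which the curve runs with parameter
  \<^term>\<open>q * t\<close>. The left side of the identity is the squared distance from this centre, that is
  \<^term>\<open>r\<^sup>2 * (cos (q * t))\<^sup>2 + a\<^sup>2 * (sin (q * t))\<^sup>2\<close>, and eliminating the cosine gives the claim.\<close>

lemma sqrt_sum_squares_polar:
  fixes \<rho> \<phi> :: real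
  assumes "0 \<le> \<rho>"
  shows "sqrt ((\<rho> * cos \<phi>)\<^sup>2 + (\<rho> * sin \<phi>)\<^sup>2) = \<rho>"
proof -
  have "(\<rho> * cos \<phi>)\<^sup>2 + (\<rho> * sin \<phi>)\<^sup>2 = \<rho>\<^sup>2 * ((cos \<phi>)\<^sup>2 + (sin \<phi>)\<^sup>2)"
    by (simp only: power_mult_distrib distrib_left)
  then show ?thesis
    using assms by simp
qed

text \<open>The bound \<^term>\<open>r < R\<close> keeps the curve away from the axis, so that this signed distance from
  the axis is the true distance and survives the square root of its square.\<close>

lemma axis_distance_pos:
  fixes R r \<theta> :: real
  assumes "0 < r" and "r < R"
  shows "0 < R + r * cos \<theta>"
proof -
  have "r * (-1) \<le> r * cos \<theta>"
    using assms(1) by (intro mult_left_mono) auto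
  then show ?thesis
    using assms(2) by simp
qed

theorem theorem13p4:
  fixes R r a :: real and p q :: nat and x y z :: "real \<Rightarrow> real"
  assumes "0 < p" and "0 < q"
    and "0 < r" and "r < R" and "0 < a"
    and "(\<lambda>t. vector [x t, y t, z t]) = S_torus_knot R r a p q"
  shows "\<forall>t. (R - sqrt ((x t)\<^sup>2 + (y t)\<^sup>2))\<^sup>2 + (z t)\<^sup>2
               = r\<^sup>2 + (a\<^sup>2 - r\<^sup>2) * (sin (real q * t))\<^sup>2"
proof
  fix t
  define \<rho> where "\<rho> = R + r * cos (real q * t)"
  have eq: "(vector [x t, y t, z t] :: real ^ 3)
      = vector [\<rho> * cos (real p * t), \<rho> * sin (real p * t), a * sin (real q * t)]"
    using fun_cong[OF assms(6), of t] by (simp add: S_torus_knot_def \<rho>_def)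
  have x: "x t = \<rho> * cos (real p * t)"
    using arg_cong[OF eq, of "\<lambda>v. v $ 1"] by simp
  have y: "y t = \<rho> * sin (real p * t)"
    using arg_cong[OF eq, of "\<lambda>v. v $ 2"] by simp
  have z: "z t = a * sin (real q * t)"
    using arg_cong[OF eq, of "\<lambda>v. v $ 3"] by simp
  have "0 \<le> \<rho>"
    unfolding \<rho>_def using axis_distance_pos[OF assms(3,4)] by (rule less_imp_le)
  then have "sqrt ((x t)\<^sup>2 + (y t)\<^sup>2) = \<rho>"
    unfolding x y by (rule sqrt_sum_squares_polar)
  then have "(R - sqrt ((x t)\<^sup>2 + (y t)\<^sup>2))\<^sup>2 + (z t)\<^sup>2
      = r\<^sup>2 * (cos (real q * t))\<^sup>2 + a\<^sup>2 * (sin (real q * t))\<^sup>2"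
    by (simp add: z \<rho>_def power_mult_distrib)
  also have "\<dots> = r\<^sup>2 + (a\<^sup>2 - r\<^sup>2) * (sin (real q * t))\<^sup>2"
    by (simp add: cos_squared_eq algebra_simps)
  finally show "(R - sqrt ((x t)\<^sup>2 + (y t)\<^sup>2))\<^sup>2 + (z t)\<^sup>2
      = r\<^sup>2 + (a\<^sup>2 - r\<^sup>2) * (sin (real q * t))\<^sup>2" .
qed

end
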